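(* (Lax pair of the two-component C3$_{b_1}$ lattice system.) Let $P,Q,R,b_1\in\mathbb C$, and let $y,z:\mathbb Z^2\to\mathbb C$ be nowhere zero with $\widetilde z\neq\widehat z$ at every lattice point. Define the $3\times3$ matrices $$L=\frac1z\begin{pmatrix}\widetilde z&0&-1\\-z\widetilde y&z&0\\ b_1\frac{\widetilde z}{y}&-R\frac{z\widetilde z}{y}&\frac1y(Pz\widetilde y-b_1)\end{pmatrix},\qquad M=\frac1z\begin{pmatrix}\widehat z&0&-1\\-z\widehat y&z&0\\ b_1\frac{\widehat z}{y}&-R\frac{z\widehat z}{y}&\frac1y(Qz\widehat y-b_1)\end{pmatrix}.$$ Then the compatibility condition $\widehat L\,M=\widetilde M\,L$ holds at every lattice point if and only if $(y,z)$ satisfies at every lattice point $$\widehat{\widetilde z}\,y=b_1+z\,\frac{P\,\widetilde y\,\widehat z-Q\,\widehat y\,\widetilde z}{\widetilde z-\widehat z},\qquad \widehat{\widetilde y}=-z\,\frac{\widetilde y-\widehat y}{\widetilde z-\widehat z}.$$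
   Context: For a function (or matrix function) $u$ on $\mathbb Z^2$: $u=u(n,m)$, $\widetilde u=u(n+1,m)$, $\widehat u=u(n,m+1)$, $\widehat{\widetilde u}=u(n+1,m+1)$. $R$ plays the role of the spectral parameter. *)

theory Defs
  imports "HOL-Analysis.Analysis"
begin

type_synonym 'a lattice = "int \<Rightarrow> int \<Rightarrow> 'a"

definition tilde :: "'a lattice \<Rightarrow> 'a lattice" where
  "tilde u = (\<lambda>n m. u (n + 1) m)"

definition hat :: "'a lattice \<Rightarrow> 'a lattice" where
  "hat u = (\<lambda>n m. u n (m + 1))"

definition scale_matrix :: "complex \<Rightarrow> complex^3^3 \<Rightarrow> complex^3^3" where
  "scale_matrix c A = (\<chi> i j. c * A $ i $ j)"

definition lax_L ::
    "complex \<Rightarrow> complex \<Rightarrow> complex \<Rightarrow> complex lattice \<Rightarrow> complex lattice \<Rightarrow> (complex^3^3) lattice" where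
  "lax_L P R b1 y z = (\<lambda>n m.
     let y0 = y n m; z0 = z n m; yt = tilde y n m; zt = tilde z n m in
     scale_matrix (1 / z0) (vector
       [vector [zt,            0,                    -1],
        vector [- z0 * yt,     z0,                   0],
        vector [b1 * (zt / y0), - R * (z0 * zt / y0), (1 / y0) * (P * z0 * yt - b1)]]))"

definition lax_M ::
    "complex \<Rightarrow> complex \<Rightarrow> complex \<Rightarrow> complex lattice \<Rightarrow> complex lattice \<Rightarrow> (complex^3^3) lattice" where
  "lax_M Q R b1 y z = (\<lambda>n m.
     let y0 = y n m; z0 = z n m; yh = hat y n m; zh = hat z n m in
     scale_matrix (1 / z0) (vector
       [vector [zh,            0,                    -1],
        vector [- z0 * yh,     z0,                   0],
        vector [b1 * (zh / y0), - R * (z0 * zh / y0), (1 / y0) * (Q * z0 * yh - b1)]]))"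

end

theory Submission imports Defs begin

text \<open>
  Both Lax matrices are instances of one matrix, with parameter \<open>P\<close> or \<open>Q\<close> and the shift taken in
  the first or second direction. At a lattice point, the \<open>(1,3)\<close> and \<open>(2,1)\<close> entries of the
  compatibility condition are the two lattice equations; the entries \<open>(1,1)\<close>, \<open>(1,2)\<close>, \<open>(2,2)\<close>
  and \<open>(2,3)\<close> hold identically. The third row then follows because, with \<open>v\<close> and \<open>w\<close> the doubly
  shifted values of \<open>y\<close> and \<open>z\<close>, the two equations make \<open>(w * y - b + P * zh * v) / yh\<close> invariant
  under exchanging the directions together with \<open>P\<close> and \<open>Q\<close>.
\<close>

definition lax_block ::
    "complex \<Rightarrow> complex \<Rightarrow> complex \<Rightarrow> complex \<Rightarrow> complex \<Rightarrow> complex \<Rightarrow> complex \<Rightarrow> complex^3^3" where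
  "lax_block K R b y z y' z' = scale_matrix (1 / z) (vector
       [vector [z',            0,                    -1],
        vector [- z * y',     z,                   0],
        vector [b * (z' / y), - R * (z * z' / y), (1 / y) * (K * z * y' - b)]])"

lemma lax_L_eq_block:
  "lax_L P R b y z n m = lax_block P R b (y n m) (z n m) (y (n + 1) m) (z (n + 1) m)"
  by (simp add: lax_L_def lax_block_def tilde_def Let_def)

lemma lax_M_eq_block:
  "lax_M Q R b y z n m = lax_block Q R b (y n m) (z n m) (y n (m + 1)) (z n (m + 1))"
  by (simp add: lax_M_def lax_block_def hat_def Let_def)

text \<open>The third row is arranged so that \<open>P\<close> and the direction enter it mostly
  through \<open>(w * y - b + P * zh * v) / yh\<close>, ready to be rewritten as one symbol.\<close>

lemma lax_block_mult:
  assumes "y \<noteq> 0" "z \<noteq> 0" "yh \<noteq> 0" "zh \<noteq> 0"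
  shows "lax_block P R b yh zh v w ** lax_block Q R b y z yh zh = vector
    [vector [(w - b / y) / z, R / y, - (w * y - b + Q * z * yh) / (y * z * zh)],
     vector [- (v * zh + z * yh) / z, 1, v / z],
     vector [b * ((w * y - b + P * zh * v) / yh) / (y * z) + R * w,
             - R * ((w * y - b + P * zh * v) / yh) / y,
             (Q * z * (P * v - b / zh) - b * ((w * y - b + P * zh * v) / yh) / zh) / (y * z)]]"
  using assms
  by (simp add: lax_block_def scale_matrix_def matrix_matrix_mult_def vec_eq_iff sum_3 forall_3)
     (simp add: field_simps)

lemma lax_block_compatible_iff:
  assumes nz: "y \<noteq> 0" "z \<noteq> 0" "yt \<noteq> 0" "zt \<noteq> 0" "yh \<noteq> 0" "zh \<noteq> 0" and ne: "zt \<noteq> zh"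
  shows "lax_block P R b yh zh v w ** lax_block Q R b y z yh zh
           = lax_block Q R b yt zt v w ** lax_block P R b y z yt zt
     \<longleftrightarrow> w * y = b + z * ((P * yt * zh - Q * yh * zt) / (zt - zh))
         \<and> v = - z * ((yt - yh) / (zt - zh))"
    (is "?lhs = ?rhs \<longleftrightarrow> ?eq1 \<and> ?eq2")
proof -
  have d: "zt - zh \<noteq> 0" using ne by simp
  \<comment> \<open>Clearing denominators gives an equation linear in \<open>w\<close> with
    coefficient \<open>y * (zt - zh)\<close>, which is nonzero.\<close>
  have entry13: "- (w * y - b + Q * z * yh) / (y * z * zh) = - (w * y - b + P * z * yt) / (y * z * zt)
      \<longleftrightarrow> ?eq1"
    using nz d by (simp add: divide_simps) algebra
  have entry21: "- (v * zh + z * yh) / z = - (v * zt + z * yt) / z \<longleftrightarrow> ?eq2"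
    using nz d by (simp add: divide_simps) algebra
  show ?thesis
  proof
    assume "?lhs = ?rhs"
    then have "?lhs $ 1 $ 3 = ?rhs $ 1 $ 3" "?lhs $ 2 $ 1 = ?rhs $ 2 $ 1" by simp_all
    then show "?eq1 \<and> ?eq2"
      unfolding lax_block_mult[OF nz(1,2,5,6)] lax_block_mult[OF nz(1-4)] vector_3
      using entry13 entry21 by blast
  next
    assume eqs: "?eq1 \<and> ?eq2"
    \<comment> \<open>Common value of the two third-row quantities; swapping \<open>zt\<close>,
      \<open>zh\<close> together with \<open>Q\<close>, \<open>P\<close> fixes it.\<close>
    define T where "T = z * (P * zh - Q * zt) / (zt - zh)"
    have w: "w * y - b = z * (P * yt * zh - Q * yh * zt) / (zt - zh)"
      using eqs by simp
    have v: "v = - z * (yt - yh) / (zt - zh)"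
      using eqs by simp
    have Th: "(w * y - b + P * zh * v) / yh = T"
      unfolding w v T_def using nz d by (simp add: divide_simps) algebra
    have Tt: "(w * y - b + Q * zt * v) / yt = T"
      unfolding w v T_def using nz d by (simp add: divide_simps) algebra
    \<comment> \<open>The two sides of \<open>entry33\<close> differ by \<open>b / (zt * zh)\<close>
      times the defect in this relation.\<close>
    have "T * (zt - zh) = z * (P * zh - Q * zt)"
      unfolding T_def using d by simp
    then have entry33: "Q * z * (P * v - b / zh) - b * T / zh = P * z * (Q * v - b / zt) - b * T / zt"
      using nz by (simp add: divide_simps) algebra
    show "?lhs = ?rhs"
      unfolding lax_block_mult[OF nz(1,2,5,6)] lax_block_mult[OF nz(1-4)] Th Tt
        entry13[THEN iffD2, OF eqs[THEN conjunct1]] entry21[THEN iffD2, OF eqs[THEN conjunct2]] entry33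
      by (rule refl)
  qed
qed

theorem mainTheorem14:
  fixes P Q R b1 :: complex and y z :: "complex lattice"
  assumes "\<And>n m. y n m \<noteq> 0"
    and "\<And>n m. z n m \<noteq> 0"
    and "\<And>n m. tilde z n m \<noteq> hat z n m"
  shows "(\<forall>n m. hat (lax_L P R b1 y z) n m ** lax_M Q R b1 y z n m
                = tilde (lax_M Q R b1 y z) n m ** lax_L P R b1 y z n m)
     \<longleftrightarrow> (\<forall>n m. hat (tilde z) n m * y n m
                = b1 + z n m * ((P * tilde y n m * hat z n m - Q * hat y n m * tilde z n m)
                                / (tilde z n m - hat z n m))
            \<and> hat (tilde y) n m
                = - z n m * ((tilde y n m - hat y n m) / (tilde z n m - hat z n m)))"
proof -
  have ne: "z (n + 1) m \<noteq> z n (m + 1)" for n m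
    using assms(3)[of n m] by (simp add: tilde_def hat_def)
  show ?thesis
    unfolding tilde_def hat_def lax_L_eq_block lax_M_eq_block
    by (simp only: lax_block_compatible_iff[OF assms(1,2) assms(1,2) assms(1,2) ne])
qed

end
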